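(* Let $\mathbb{T}$ be a time scale and let $a,b\in\mathbb{T}$ with $a<b$. If $f=[\underline{f},\overline{f}]:[a,b]_{\mathbb{T}}\to\mathbb{R}_{\mathcal{I}}$ is continuous, then $f$ is $IR$ $\Delta$-integrable on $[a,b]_{\mathbb{T}}$ and $$(IR)\int_a^b f(t)\Delta t=\Big[\int_a^b\underline{f}(t)\Delta t,\ \int_a^b\overline{f}(t)\Delta t\Big],$$ where the integrals on the right are Riemann $\Delta$-integrals of real-valued functions.
   Context: A time scale $\mathbb{T}$ is a nonempty closed subset of $\mathbb{R}$. For $a,b\in\mathbb{T}$, $[a,b]_{\mathbb{T}}=\{t\in\mathbb{T}:a\le t\le b\}$ and $[a,b)_{\mathbb{T}}=\{t\in\mathbb{T}:a\le t<b\}$. The backward jump operator is $\rho(t)=\sup\{s\in\mathbb{T}:s<t\}$. $\mathbb{R}_{\mathcal{I}}$ is the set of nonempty compact intervals $[\underline{u},\overline{u}]\subset\mathbb{R}$, $\underline{u}\le\overline{u}$ (degenerate intervals allowed), with metric $d([\underline{u},\overline{u}],[\underline{v},\overline{v}])=\max\{|\underline{u}-\underline{v}|,|\overline{u}-\overline{v}|\}$, addition $[\underline{u},\overline{u}]+[\underline{v},\overline{v}]=[\underline{u}+\underline{v},\overline{u}+\overline{v}]$ and, for $\lambda>0$, $\lambda[\underline{u},\overline{u}]=[\lambda\underline{u},\lambda\overline{u}]$. Continuity of $f$ is with respect to $d$. A division of $[a,b]_{\mathbb{T}}$ is a finite set $D=\{a=t_0<t_1<\cdots<t_n=b\}\subseteq[a,b]_{\mathbb{T}}$.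 For $\delta>0$, $\mathcal{D}(\delta,[a,b]_{\mathbb{T}})$ is the (nonempty) set of divisions such that for each $i$ either $t_i-t_{i-1}\le\delta$, or $t_i-t_{i-1}>\delta$ and $\rho(t_i)=t_{i-1}$. A Riemann $\Delta$-sum of a function $f$ (with values in $\mathbb{R}$ or $\mathbb{R}_{\mathcal{I}}$) corresponding to $D\in\mathcal{D}(\delta,[a,b]_{\mathbb{T}})$ is $S(f,D,\delta)=\sum_{i=1}^n f(\xi_i)(t_i-t_{i-1})$ with arbitrary $\xi_i\in[t_{i-1},t_i)_{\mathbb{T}}$. A function $f:[a,b]_{\mathbb{T}}\to\mathbb{R}_{\mathcal{I}}$ is $IR$ $\Delta$-integrable with integral $A=(IR)\int_a^b f(t)\Delta t\in\mathbb{R}_{\mathcal{I}}$ if for every $\epsilon>0$ there is $\delta>0$ such that $d(S(f,D,\delta),A)<\epsilon$ for all $D\in\mathcal{D}(\delta,[a,b]_{\mathbb{T}})$ and all choices of the $\xi_i$. The Riemann $\Delta$-integral $\int_a^b f(t)\Delta t\in\mathbb{R}$ of a real-valued $f$ is defined in the same way with $|S(f,D,\delta)-A|<\epsilon$. *)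

theory Defs
  imports "HOL-Analysis.Analysis" "HOL-Library.Interval"
begin

section \<open>Intervals\<close>

text \<open>
  The library provides nonempty compact intervals (degenerate ones included) as the type
  \<^typ>\<open>real interval\<close>, with endpointwise addition. Its topological space instance is not
  used here: that definition of open sets also refers to \<^term>\<open>Interval (x, y)\<close> with
  \<^prop>\<open>y < x\<close>, an unspecified value, so it is not known to be the topology of the metric below.
\<close>

definition interval_dist :: "real interval \<Rightarrow> real interval \<Rightarrow> real" where
  "interval_dist u v = max \<bar>lower u - lower v\<bar> \<bar>upper u - upper v\<bar>"

lemma Metric_space_interval_dist: "Metric_space UNIV interval_dist"
  by (unfold_locales) (auto simp: interval_dist_def interval_eq_iff)

definition interval_continuous_on :: "real set \<Rightarrow> (real \<Rightarrow> real interval) \<Rightarrow> bool" where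
  "interval_continuous_on S f \<longleftrightarrow>
     continuous_map (top_of_set S) (Metric_space.mtopology UNIV interval_dist) f"

text \<open>
  Scaling by a nonnegative real is the library's interval product with a degenerate interval.
\<close>

lemma
  assumes "0 \<le> c"
  shows lower_times_interval_of: "lower (u * interval_of c) = c * lower (u :: real interval)"
    and upper_times_interval_of: "upper (u * interval_of c) = c * upper u"
  using mult_left_mono[OF lower_le_upper[of u] assms]
  by (simp_all add: lower_times upper_times mult.commute)

section \<open>Time scales and divisions\<close>

definition time_scale :: "real set \<Rightarrow> bool" where
  "time_scale T \<longleftrightarrow> closed T \<and> T \<noteq> {}"

definition ts_Icc :: "real set \<Rightarrow> real \<Rightarrow> real \<Rightarrow> real set" where
  "ts_Icc T a b = {t \<in> T. a \<le> t \<and> t \<le> b}"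

definition ts_Ico :: "real set \<Rightarrow> real \<Rightarrow> real \<Rightarrow> real set" where
  "ts_Ico T a b = {t \<in> T. a \<le> t \<and> t < b}"

text \<open>
  Below, the backward jump is only evaluated at points \<open>t\<close> of \<open>T\<close> with some smaller point of \<open>T\<close>,
  where the supremum is proper.
\<close>

definition backward_jump :: "real set \<Rightarrow> real \<Rightarrow> real" where
  "backward_jump T t = Sup {s \<in> T. s < t}"

text \<open>
  A division \<open>{t\<^sub>0 < \<dots> < t\<^sub>n}\<close> is given by its number \<open>n\<close> of subintervals and the enumeration \<open>t\<close>
  (values beyond index \<open>n\<close> are irrelevant).
\<close>

definition ts_division :: "real set \<Rightarrow> real \<Rightarrow> real \<Rightarrow> nat \<Rightarrow> (nat \<Rightarrow> real) \<Rightarrow> bool" where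
  "ts_division T a b n t \<longleftrightarrow>
     t 0 = a \<and> t n = b \<and> (\<forall>i\<le>n. t i \<in> ts_Icc T a b) \<and> (\<forall>i\<in>{1..n}. t (i - 1) < t i)"

definition delta_division ::
    "real \<Rightarrow> real set \<Rightarrow> real \<Rightarrow> real \<Rightarrow> nat \<Rightarrow> (nat \<Rightarrow> real) \<Rightarrow> bool" where
  "delta_division \<delta> T a b n t \<longleftrightarrow>
     ts_division T a b n t \<and>
     (\<forall>i\<in>{1..n}. t i - t (i - 1) \<le> \<delta> \<or>
                  (t i - t (i - 1) > \<delta> \<and> backward_jump T (t i) = t (i - 1)))"

definition division_tags :: "real set \<Rightarrow> nat \<Rightarrow> (nat \<Rightarrow> real) \<Rightarrow> (nat \<Rightarrow> real) \<Rightarrow> bool" where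
  "division_tags T n t \<xi> \<longleftrightarrow> (\<forall>i\<in>{1..n}. \<xi> i \<in> ts_Ico T (t (i - 1)) (t i))"

section \<open>Riemann delta integrals\<close>

definition real_delta_sum ::
    "(real \<Rightarrow> real) \<Rightarrow> nat \<Rightarrow> (nat \<Rightarrow> real) \<Rightarrow> (nat \<Rightarrow> real) \<Rightarrow> real" where
  "real_delta_sum f n t \<xi> = (\<Sum>i=1..n. f (\<xi> i) * (t i - t (i - 1)))"

definition interval_delta_sum ::
    "(real \<Rightarrow> real interval) \<Rightarrow> nat \<Rightarrow> (nat \<Rightarrow> real) \<Rightarrow> (nat \<Rightarrow> real) \<Rightarrow> real interval" where
  "interval_delta_sum f n t \<xi> = (\<Sum>i=1..n. f (\<xi> i) * interval_of (t i - t (i - 1)))"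

definition has_delta_integral ::
    "real set \<Rightarrow> real \<Rightarrow> real \<Rightarrow> (real \<Rightarrow> real) \<Rightarrow> real \<Rightarrow> bool" where
  "has_delta_integral T a b f A \<longleftrightarrow>
     (\<forall>\<epsilon>>0. \<exists>\<delta>>0. \<forall>n t \<xi>. delta_division \<delta> T a b n t \<and> division_tags T n t \<xi> \<longrightarrow>
        \<bar>real_delta_sum f n t \<xi> - A\<bar> < \<epsilon>)"

definition has_IR_delta_integral ::
    "real set \<Rightarrow> real \<Rightarrow> real \<Rightarrow> (real \<Rightarrow> real interval) \<Rightarrow> real interval \<Rightarrow> bool" where
  "has_IR_delta_integral T a b f A \<longleftrightarrow>
     (\<forall>\<epsilon>>0. \<exists>\<delta>>0. \<forall>n t \<xi>. delta_division \<delta> T a b n t \<and> division_tags T n t \<xi> \<longrightarrow>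
        interval_dist (interval_delta_sum f n t \<xi>) A < \<epsilon>)"

definition delta_integrable :: "real set \<Rightarrow> real \<Rightarrow> real \<Rightarrow> (real \<Rightarrow> real) \<Rightarrow> bool" where
  "delta_integrable T a b f \<longleftrightarrow> (\<exists>A. has_delta_integral T a b f A)"

definition IR_delta_integrable ::
    "real set \<Rightarrow> real \<Rightarrow> real \<Rightarrow> (real \<Rightarrow> real interval) \<Rightarrow> bool" where
  "IR_delta_integrable T a b f \<longleftrightarrow> (\<exists>A. has_IR_delta_integral T a b f A)"

definition delta_integral :: "real set \<Rightarrow> real \<Rightarrow> real \<Rightarrow> (real \<Rightarrow> real) \<Rightarrow> real" where
  "delta_integral T a b f = (THE A. has_delta_integral T a b f A)"

definition IR_delta_integral ::
    "real set \<Rightarrow> real \<Rightarrow> real \<Rightarrow> (real \<Rightarrow> real interval) \<Rightarrow> real interval" where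
  "IR_delta_integral T a b f = (THE A. has_IR_delta_integral T a b f A)"

end

theory Submission
  imports Defs
begin

text \<open>
  The real Riemann delta-integral of a continuous function is an ordinary integral in disguise.
  Let \<open>p(x)\<close> be the last point of \<open>T\<close> that is at most \<open>x\<close>. A continuous \<open>g\<close> on \<open>[a,b]\<^sub>T\<close> extends to all of \<open>[a,b]\<close> as \<open>g \<circ> p\<close>, constant on the
  gaps of \<open>T\<close>. This extension is bounded and measurable (\<open>p\<close> is monotone), so it has an integral \<open>I\<close>.
  On a piece \<open>[u,v)\<close> of a fine division with tag \<open>\<xi>\<close>, the point \<open>p(x)\<close> stays in \<open>[u,v)\<^sub>T\<close>. If the piece is
  short, uniform continuity bounds \<open>\<bar>g(p(x)) - g(\<xi>)\<bar>\<close>. If it is long, \<open>u\<close> is the predecessor of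
  \<open>v\<close>, hence the only point of \<open>[u,v)\<^sub>T\<close>, and \<open>p(x) = \<xi> = u\<close>. So the Riemann sums converge
  to \<open>I\<close> (\<open>continuous_has_delta_integral\<close>), with no error at all contributed by the gaps.

  Limits of Riemann sums are unique because there are divisions of every fineness
  (\<open>delta_division_exists\<close>). Finally, interval sums are computed endpoint by endpoint, and the
  metric on intervals is the maximum of the endpoint distances, so an interval is
  the integral of an interval-valued function exactly when its endpoints are the integrals of the
  endpoint functions (\<open>has_IR_delta_integral_iff\<close>).
  The two integrals bound an interval because \<open>g \<mapsto> g \<circ> p\<close> and the ordinary integral are monotone.
\<close>

section \<open>Existence of fine divisions and uniqueness of the integral\<close>

lemma delta_division_mono:
  assumes "delta_division \<delta> T a b n t" "\<delta> \<le> \<delta>'"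
  shows "delta_division \<delta>' T a b n t"
  using assms unfolding delta_division_def by force

lemma delta_division_step:
  assumes "delta_division \<delta> T a b n t" "i \<in> {1..n}"
  shows "t (i - 1) < t i" "t (i - 1) \<in> ts_Icc T a b" "t i \<in> ts_Icc T a b"
    "t i - t (i - 1) \<le> \<delta> \<or> backward_jump T (t i) = t (i - 1)"
  using assms unfolding delta_division_def ts_division_def by auto

lemma delta_division_append:
  assumes D: "delta_division \<delta> T a c n t"
    and d: "d \<in> T" "c < d" "d - c \<le> \<delta> \<or> backward_jump T d = c"
  shows "delta_division \<delta> T a d (Suc n) (t(Suc n := d))"
proof -
  have c: "t n = c" and t: "\<And>i. i \<le> n \<Longrightarrow> t i \<in> ts_Icc T a c"
    using D by (auto simp: delta_division_def ts_division_def)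
  have "(t(Suc n := d)) i \<in> ts_Icc T a d" if "i \<le> Suc n" for i
    using t[of i] t[of n] that d by (cases "i = Suc n") (auto simp: ts_Icc_def)
  then show ?thesis
    using D d c by (auto simp: delta_division_def ts_division_def le_Suc_eq)
qed

text \<open>
  The induction is on the number of steps of length \<open>\<delta>\<close> that separate \<open>c\<close> from \<open>a\<close>. The time scale is
  split at \<open>c - \<delta>\<close>: its last point \<open>r\<close> below the split is covered by the induction hypothesis, its
  first point \<open>s\<close> above it is within \<open>\<delta>\<close> of \<open>c\<close>, and nothing lies between, so \<open>r\<close> is \<open>s\<close>
  or its predecessor.
\<close>

lemma delta_division_exists_aux:
  assumes "time_scale T" "a \<in> T" "\<delta> > 0"
  shows "c \<in> T \<Longrightarrow> a \<le> c \<Longrightarrow> c - a \<le> real m * \<delta> \<Longrightarrow> \<exists>n t. delta_division \<delta> T a c n t"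
proof (induction m arbitrary: c)
  case 0
  then have "c = a" by simp
  then have "delta_division \<delta> T a c 0 (\<lambda>_. a)"
    using 0 by (auto simp: delta_division_def ts_division_def ts_Icc_def)
  then show ?case by blast
next
  case (Suc m)
  have cl: "closed T" using assms(1) by (simp add: time_scale_def)
  show ?case
  proof (cases "c - \<delta> < a")
    case True
    have triv: "delta_division \<delta> T a a 0 (\<lambda>_. a)"
      using assms by (auto simp: delta_division_def ts_division_def ts_Icc_def)
    show ?thesis
    proof (cases "c = a")
      case False
      with True Suc.prems show ?thesis
        using delta_division_append[OF triv, of c] by fastforce
    qed (use triv in blast)
  next
    case False
    define r where "r = Sup (T \<inter> {a..c - \<delta>})"
    define s where "s = Inf (T \<inter> {c - \<delta>..c})"
    have ne: "T \<inter> {a..c - \<delta>} \<noteq> {}" "T \<inter> {c - \<delta>..c} \<noteq> {}"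
      using False assms Suc.prems by auto
    have bd: "bdd_above (T \<inter> {a..c - \<delta>})" "bdd_below (T \<inter> {c - \<delta>..c})"
      by auto
    have r: "r \<in> T \<inter> {a..c - \<delta>}" unfolding r_def
      using ne bd cl by (intro closed_contains_Sup) auto
    have s: "s \<in> T \<inter> {c - \<delta>..c}" unfolding s_def
      using ne bd cl by (intro closed_contains_Inf) auto
    have r_max: "x \<le> r" if "x \<in> T" "a \<le> x" "x \<le> c - \<delta>" for x
      unfolding r_def using that bd by (intro cSup_upper) auto
    have s_min: "s \<le> x" if "x \<in> T" "c - \<delta> \<le> x" "x \<le> c" for x
      unfolding s_def using that bd by (intro cInf_lower) auto
    have "r - a \<le> real m * \<delta>"
      using r Suc.prems by (auto simp: algebra_simps)
    then obtain n t where nt: "delta_division \<delta> T a r n t"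
      using Suc.IH[of r] r by auto
    have "\<exists>n t. delta_division \<delta> T a s n t"
    proof (cases "s = r")
      case False
      then have "r < s" using r s by auto
      have "x \<le> r" if "x \<in> T" "x < s" for x
      proof (cases "x \<le> c - \<delta>")
        case True
        then show ?thesis using r r_max[of x] that by (cases "a \<le> x") auto
      next
        case False
        then show ?thesis using s_min[of x] s that by auto
      qed
      then have "backward_jump T s = r"
        unfolding backward_jump_def using r \<open>r < s\<close> by (intro cSup_eq_maximum) auto
      then show ?thesis
        using delta_division_append[OF nt, of s] s \<open>r < s\<close> by blast
    qed (use nt in blast)
    then obtain n' t' where nt': "delta_division \<delta> T a s n' t'" by blast
    show ?thesis
    proof (cases "c = s")
      case False
      then have "s < c" "c - s \<le> \<delta>" using s by auto
      then show ?thesis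
        using delta_division_append[OF nt', of c] Suc.prems by blast
    qed (use nt' in blast)
  qed
qed

lemma delta_division_exists:
  assumes "time_scale T" "a \<in> T" "b \<in> T" "a \<le> b" "\<delta> > 0"
  obtains n t \<xi> where "delta_division \<delta> T a b n t" "division_tags T n t \<xi>"
proof -
  obtain m where "(b - a) / \<delta> < real m" using reals_Archimedean2 by blast
  then have "b - a \<le> real m * \<delta>" using assms by (simp add: field_simps)
  then obtain n t where nt: "delta_division \<delta> T a b n t"
    using delta_division_exists_aux assms by blast
  then have "division_tags T n t (\<lambda>i. t (i - 1))"
    using delta_division_step[OF nt] by (auto simp: division_tags_def ts_Ico_def ts_Icc_def)
  with nt show ?thesis using that by blast
qed

lemma has_delta_integral_unique:
  assumes "time_scale T" "a \<in> T" "b \<in> T" "a \<le> b"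
    and A: "has_delta_integral T a b g A" and B: "has_delta_integral T a b g B"
  shows "A = B"
proof (rule ccontr)
  assume "A \<noteq> B"
  then have pos: "\<bar>A - B\<bar> / 2 > 0" by simp
  obtain d1 where d1: "d1 > 0" "\<And>n t \<xi>. delta_division d1 T a b n t \<and> division_tags T n t \<xi> \<Longrightarrow>
      \<bar>real_delta_sum g n t \<xi> - A\<bar> < \<bar>A - B\<bar> / 2"
    using A pos unfolding has_delta_integral_def by meson
  obtain d2 where d2: "d2 > 0" "\<And>n t \<xi>. delta_division d2 T a b n t \<and> division_tags T n t \<xi> \<Longrightarrow>
      \<bar>real_delta_sum g n t \<xi> - B\<bar> < \<bar>A - B\<bar> / 2"
    using B pos unfolding has_delta_integral_def by meson
  obtain n t \<xi> where D: "delta_division (min d1 d2) T a b n t" and tags: "division_tags T n t \<xi>"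
    using delta_division_exists[of T a b "min d1 d2"] assms(1-4) d1(1) d2(1) by auto
  let ?S = "real_delta_sum g n t \<xi>"
  have "\<bar>real_delta_sum g n t \<xi> - A\<bar> < \<bar>A - B\<bar> / 2" "\<bar>real_delta_sum g n t \<xi> - B\<bar> < \<bar>A - B\<bar> / 2"
    using d1(2) d2(2) tags delta_division_mono[OF D] by auto
  then have "\<bar>?S - A\<bar> + \<bar>?S - B\<bar> < \<bar>A - B\<bar>" by (simp add: field_simps)
  then show False by linarith
qed

lemma delta_integral_eq:
  assumes "time_scale T" "a \<in> T" "b \<in> T" "a \<le> b" "has_delta_integral T a b g A"
  shows "delta_integral T a b g = A"
  unfolding delta_integral_def using assms has_delta_integral_unique by (blast intro: the_equality)

section \<open>Delta-integrals of continuous functions as ordinary integrals\<close>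

definition ts_floor :: "real set \<Rightarrow> real \<Rightarrow> real" where
  "ts_floor T x = Sup {s \<in> T. s \<le> x}"

lemma ts_floor:
  assumes "closed T" "u \<in> T" "u \<le> x"
  shows "ts_floor T x \<in> T" "u \<le> ts_floor T x" "ts_floor T x \<le> x"
proof -
  have bd: "bdd_above {s \<in> T. s \<le> x}" by (auto intro!: bdd_aboveI)
  have eq: "{s \<in> T. s \<le> x} = T \<inter> {..x}" by auto
  have "ts_floor T x \<in> {s \<in> T. s \<le> x}" unfolding ts_floor_def
  proof (rule closed_contains_Sup)
    show "closed {s \<in> T. s \<le> x}" unfolding eq using assms by blast
  qed (use bd assms in auto)
  then show "ts_floor T x \<in> T" "ts_floor T x \<le> x" by auto
  show "u \<le> ts_floor T x"
    unfolding ts_floor_def using assms bd by (intro cSup_upper) auto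
qed

lemma ts_floor_mono:
  assumes "closed T" "u \<in> T" "u \<le> x" "x \<le> y"
  shows "ts_floor T x \<le> ts_floor T y"
  using ts_floor[OF assms(1-3)] ts_floor(2)[OF assms(1), of "ts_floor T x" y] assms by auto

lemma compact_ts_Icc: "closed T \<Longrightarrow> compact (ts_Icc T a b)"
proof -
  assume "closed T"
  moreover have "ts_Icc T a b = {a..b} \<inter> T" by (auto simp: ts_Icc_def)
  ultimately show ?thesis by (simp add: compact_Int_closed)
qed

text \<open>
  The integrand is bounded, so measurability suffices, and that comes from monotonicity of the floor.
  Since the floor is unspecified to the left of \<open>T\<close>, its argument is first clamped below by \<open>a\<close>, which
  makes it monotone on the whole line. Likewise \<open>g\<close> is extended by \<open>0\<close> off the closed set
  \<open>[a,b]\<^sub>T\<close>, which keeps it Borel measurable.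
\<close>

lemma integrable_ts_floor_comp:
  fixes g :: "real \<Rightarrow> real"
  assumes "closed T" "a \<in> T" and g: "continuous_on (ts_Icc T a b) g"
  shows "(\<lambda>x. g (ts_floor T x)) integrable_on {a..b}"
proof -
  let ?K = "ts_Icc T a b"
  let ?p = "\<lambda>x. ts_floor T (max a x)"
  let ?h = "\<lambda>y. if y \<in> ?K then g y else 0"
  have p: "ts_floor T x \<in> ?K" if "x \<in> {a..b}" for x
    using ts_floor[OF assms(1,2), of x] that by (auto simp: ts_Icc_def)
  have "mono ?p"
    by (intro monoI ts_floor_mono[OF assms(1,2)]) auto
  then have "?p \<in> borel_measurable borel"
    by (rule borel_measurable_mono)
  moreover have "?h \<in> borel_measurable borel"
    using g compact_ts_Icc[OF assms(1), of a b]
    by (intro borel_measurable_continuous_on_if) (auto intro: borel_closed compact_imp_closed)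
  ultimately have "(\<lambda>x. ?h (?p x)) \<in> borel_measurable borel"
    by (rule measurable_compose)
  then have meas: "(\<lambda>x. ?h (?p x)) \<in> borel_measurable (lebesgue_on {a..b})"
    by (simp add: borel_measurable_if_D measurable_restrict_space1 measurable_completion)
  have "compact (g ` ?K)"
    using g compact_ts_Icc[OF assms(1)] by (rule compact_continuous_image)
  then obtain B where B: "\<And>y. y \<in> ?K \<Longrightarrow> \<bar>g y\<bar> \<le> B"
    using compact_imp_bounded[of "g ` ?K"] unfolding bounded_iff real_norm_def by blast
  have "(\<lambda>x. ?h (?p x)) integrable_on {a..b}"
  proof (rule measurable_bounded_by_integrable_imp_integrable[OF meas])
    show "(\<lambda>x. \<bar>B\<bar>) integrable_on {a..b}" by (rule integrable_const_ivl)
    show "norm (?h (?p x)) \<le> \<bar>B\<bar>" for x using B[of "?p x"] by auto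
  qed auto
  then show ?thesis
    by (rule integrable_eq) (use p in \<open>auto simp: max_def\<close>)
qed

text \<open>
  A piece of a division is either short, so that \<open>\<xi>\<close> and \<open>y\<close> are close, or has \<open>u\<close> as the only point
  of \<open>[u,v)\<^sub>T\<close>, so that they coincide.
\<close>

lemma tags_close_on_piece:
  assumes "\<xi> \<in> ts_Ico T u v" "y \<in> ts_Ico T u v" "v - u \<le> \<delta> \<or> backward_jump T v = u" "\<delta> > 0"
  shows "\<bar>y - \<xi>\<bar> < \<delta>"
  using assms(3)
proof
  assume "backward_jump T v = u"
  moreover have "bdd_above {s \<in> T. s < v}" by (auto intro!: bdd_aboveI[of _ v])
  ultimately have "s \<le> u" if "s \<in> T" "s < v" for s
    using cSup_upper[of s "{s \<in> T. s < v}"] that by (auto simp: backward_jump_def)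
  from this[of \<xi>] this[of y] have "\<xi> = u" "y = u"
    using assms(1,2) by (auto simp: ts_Ico_def)
  then show ?thesis using \<open>\<delta> > 0\<close> by simp
qed (use assms in \<open>auto simp: ts_Ico_def\<close>)

text \<open>
  A Riemann sum is the integral of a step function, so closeness to \<open>G\<close> on each piece bounds the
  error piece by piece.
\<close>

lemma delta_sum_error:
  assumes int: "G integrable_on {a..b}" and D: "delta_division \<delta> T a b n t"
    and close: "\<And>i x. i \<in> {1..n} \<Longrightarrow> t (i - 1) \<le> x \<Longrightarrow> x < t i \<Longrightarrow> \<bar>G x - g (\<xi> i)\<bar> \<le> \<eta>"
    and "\<eta> \<ge> 0"
  shows "\<bar>real_delta_sum g n t \<xi> - integral {a..b} G\<bar> \<le> \<eta> * (b - a)"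
proof -
  have t0: "t 0 = a" and tn: "t n = b"
    using D by (auto simp: delta_division_def ts_division_def)
  let ?F = "\<lambda>i. integral {a..t i} G"
  have piece: "\<bar>g (\<xi> i) * (t i - t (i - 1)) - (?F i - ?F (i - 1))\<bar> \<le> \<eta> * (t i - t (i - 1))"
    if i: "i \<in> {1..n}" for i
  proof -
    let ?u = "t (i - 1)" and ?v = "t i"
    have uv: "?u < ?v" "a \<le> ?u" "?v \<le> b"
      using delta_division_step[OF D i] by (auto simp: ts_Icc_def)
    have "integral {a..?u} G + integral {?u..?v} G = integral {a..?v} G"
      using uv int by (intro Henstock_Kurzweil_Integration.integral_combine)
        (auto intro: integrable_on_subinterval)
    moreover have "G integrable_on {?u..?v}"
      using uv int by (auto intro: integrable_on_subinterval)
    ultimately have "(G has_integral (?F i - ?F (i - 1))) {?u..?v}"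
      by (simp add: has_integral_integrable_integral)
    then have "((\<lambda>x. g (\<xi> i) - G x) has_integral
        (g (\<xi> i) * (?v - ?u) - (?F i - ?F (i - 1)))) (cbox ?u ?v)"
      using has_integral_diff[OF has_integral_const_real[of "g (\<xi> i)" ?u ?v]] uv
      by (simp add: mult.commute)
    \<comment> \<open>the right endpoint belongs to the next piece, so the bound may fail there\<close>
    then have "norm (g (\<xi> i) * (?v - ?u) - (?F i - ?F (i - 1))) \<le> \<eta> * measure lborel (cbox ?u ?v)"
      using close[OF i] \<open>\<eta> \<ge> 0\<close>
      by (intro has_integral_bound_spike_finite[of \<eta> "{?v}"])
        (auto simp: abs_minus_commute)
    then show ?thesis using uv by simp
  qed
  have telescope: "(\<Sum>i=1..n. h i - h (i - 1)) = h n - h 0" for h :: "nat \<Rightarrow> real"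
    by (induction n) (auto)
  have "integral {a..b} G = (\<Sum>i=1..n. ?F i - ?F (i - 1))"
    unfolding telescope[of ?F] t0 tn by simp
  then have "real_delta_sum g n t \<xi> - integral {a..b} G =
      (\<Sum>i=1..n. g (\<xi> i) * (t i - t (i - 1)) - (?F i - ?F (i - 1)))"
    unfolding real_delta_sum_def by (simp only: sum_subtractf)
  also have "\<bar>\<dots>\<bar> \<le> (\<Sum>i=1..n. \<eta> * (t i - t (i - 1)))"
    by (rule order_trans[OF sum_abs sum_mono]) (use piece in auto)
  also have "\<dots> = \<eta> * (b - a)"
    unfolding sum_distrib_left[symmetric] telescope[of t] t0 tn ..
  finally show ?thesis .
qed

lemma continuous_has_delta_integral:
  assumes "time_scale T" "a \<in> T" "a < b" and g: "continuous_on (ts_Icc T a b) g"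
  shows "has_delta_integral T a b g (integral {a..b} (\<lambda>x. g (ts_floor T x)))"
  unfolding has_delta_integral_def
proof (intro allI impI)
  fix \<epsilon> :: real assume "\<epsilon> > 0"
  have cl: "closed T" using assms(1) by (simp add: time_scale_def)
  \<comment> \<open>half of the allowed error, spread over \<open>[a,b]\<close>, keeps the final inequality strict\<close>
  define \<eta> where "\<eta> = \<epsilon> / (2 * (b - a))"
  have \<eta>: "\<eta> > 0" "\<eta> * (b - a) < \<epsilon>"
    using \<open>\<epsilon> > 0\<close> \<open>a < b\<close> by (auto simp: \<eta>_def field_simps)
  have "uniformly_continuous_on (ts_Icc T a b) g"
    using g compact_ts_Icc[OF cl] by (rule compact_uniformly_continuous)
  then obtain \<delta> where "\<delta> > 0" and \<delta>: "\<And>x y. x \<in> ts_Icc T a b \<Longrightarrow> y \<in> ts_Icc T a b \<Longrightarrow>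
      \<bar>y - x\<bar> < \<delta> \<Longrightarrow> \<bar>g y - g x\<bar> < \<eta>"
    using \<eta>(1) unfolding uniformly_continuous_on_def dist_real_def by metis
  have "\<bar>real_delta_sum g n t \<xi> - integral {a..b} (\<lambda>x. g (ts_floor T x))\<bar> < \<epsilon>"
    if D: "delta_division \<delta> T a b n t" and tags: "division_tags T n t \<xi>" for n t \<xi>
  proof -
    have "\<bar>g (ts_floor T x) - g (\<xi> i)\<bar> \<le> \<eta>"
      if i: "i \<in> {1..n}" and x: "t (i - 1) \<le> x" "x < t i" for i x
    proof -
      have step: "t (i - 1) \<in> T" "a \<le> t (i - 1)" "t i \<le> b"
        using delta_division_step[OF D i] by (auto simp: ts_Icc_def)
      have xi: "\<xi> i \<in> ts_Ico T (t (i - 1)) (t i)"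
        using tags i by (auto simp: division_tags_def)
      moreover have fl: "ts_floor T x \<in> ts_Ico T (t (i - 1)) (t i)"
        using ts_floor[OF cl step(1) x(1)] x by (auto simp: ts_Ico_def)
      ultimately have "\<bar>ts_floor T x - \<xi> i\<bar> < \<delta>"
        using delta_division_step(4)[OF D i] \<open>\<delta> > 0\<close> by (rule tags_close_on_piece)
      then show ?thesis
        using \<delta>[of "\<xi> i" "ts_floor T x"] xi fl step by (force simp: ts_Ico_def ts_Icc_def)
    qed
    then have "\<bar>real_delta_sum g n t \<xi> - integral {a..b} (\<lambda>x. g (ts_floor T x))\<bar> \<le> \<eta> * (b - a)"
      using \<eta> by (intro delta_sum_error[OF integrable_ts_floor_comp[OF cl \<open>a \<in> T\<close> g] D]) auto
    with \<eta> show ?thesis by linarith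
  qed
  with \<open>\<delta> > 0\<close> show "\<exists>\<delta>>0. \<forall>n t \<xi>. delta_division \<delta> T a b n t \<and> division_tags T n t \<xi> \<longrightarrow>
      \<bar>real_delta_sum g n t \<xi> - integral {a..b} (\<lambda>x. g (ts_floor T x))\<bar> < \<epsilon>"
    by blast
qed

section \<open>Reduction of interval-valued functions to their endpoints\<close>

lemma interval_continuous_on_endpoints:
  assumes "interval_continuous_on S f"
  shows "continuous_on S (\<lambda>t. lower (f t))" "continuous_on S (\<lambda>t. upper (f t))"
proof -
  interpret Metric_space UNIV interval_dist by (rule Metric_space_interval_dist)
  have "\<exists>d>0. \<forall>y\<in>S. dist y x < d \<longrightarrow> interval_dist (f x) (f y) < e" if "x \<in> S" "e > 0" for x e
  proof -
    have "openin (top_of_set S) {y \<in> S. f y \<in> mball (f x) e}"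
      using openin_continuous_map_preimage[OF assms[unfolded interval_continuous_on_def]
          openin_mball[of "f x" e]] by simp
    moreover have "x \<in> {y \<in> S. f y \<in> mball (f x) e}" using that by (auto simp: in_mball)
    ultimately obtain d where "d > 0" "\<And>y. y \<in> S \<Longrightarrow> dist y x < d \<Longrightarrow> f y \<in> mball (f x) e"
      unfolding openin_euclidean_subtopology_iff by blast
    then show ?thesis by (auto simp: in_mball)
  qed
  then show "continuous_on S (\<lambda>t. lower (f t))" "continuous_on S (\<lambda>t. upper (f t))"
    unfolding continuous_on_iff interval_dist_def dist_real_def
    by (fastforce simp: abs_minus_commute)+
qed

lemma endpoints_interval_delta_sum:
  assumes "delta_division \<delta> T a b n t"
  shows "lower (interval_delta_sum f n t \<xi>) = real_delta_sum (\<lambda>s. lower (f s)) n t \<xi>"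
    "upper (interval_delta_sum f n t \<xi>) = real_delta_sum (\<lambda>s. upper (f s)) n t \<xi>"
proof -
  have sums: "lower (sum h I) = (\<Sum>i\<in>I. lower (h i))" "upper (sum h I) = (\<Sum>i\<in>I. upper (h i))"
    for h :: "nat \<Rightarrow> real interval" and I
    by (induction I rule: infinite_finite_induct) auto
  have len: "0 \<le> t i - t (i - 1)" if "i \<in> {1..n}" for i
    using delta_division_step(1)[OF assms that] by simp
  show "lower (interval_delta_sum f n t \<xi>) = real_delta_sum (\<lambda>s. lower (f s)) n t \<xi>"
    "upper (interval_delta_sum f n t \<xi>) = real_delta_sum (\<lambda>s. upper (f s)) n t \<xi>"
    unfolding interval_delta_sum_def real_delta_sum_def sums
    by (intro sum.cong refl; use len in
        \<open>simp add: lower_times_interval_of upper_times_interval_of mult.commute\<close>)+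
qed

lemma has_IR_delta_integral_iff:
  "has_IR_delta_integral T a b f A \<longleftrightarrow>
     has_delta_integral T a b (\<lambda>t. lower (f t)) (lower A) \<and>
     has_delta_integral T a b (\<lambda>t. upper (f t)) (upper A)"
  (is "_ \<longleftrightarrow> ?L \<and> ?U")
proof
  have dist: "interval_dist (interval_delta_sum f n t \<xi>) A < \<epsilon> \<longleftrightarrow>
      \<bar>real_delta_sum (\<lambda>s. lower (f s)) n t \<xi> - lower A\<bar> < \<epsilon> \<and>
      \<bar>real_delta_sum (\<lambda>s. upper (f s)) n t \<xi> - upper A\<bar> < \<epsilon>"
    if "delta_division \<delta> T a b n t" for \<delta> n t \<xi> \<epsilon>
    by (simp add: interval_dist_def endpoints_interval_delta_sum[OF that])
  show "?L \<and> ?U" if IR: "has_IR_delta_integral T a b f A"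
  proof -
    have both: "\<exists>\<delta>>0. \<forall>n t \<xi>. delta_division \<delta> T a b n t \<and> division_tags T n t \<xi> \<longrightarrow>
        \<bar>real_delta_sum (\<lambda>s. lower (f s)) n t \<xi> - lower A\<bar> < \<epsilon> \<and>
        \<bar>real_delta_sum (\<lambda>s. upper (f s)) n t \<xi> - upper A\<bar> < \<epsilon>"
      if "\<epsilon> > 0" for \<epsilon>
    proof -
      obtain \<delta> where "\<delta> > 0" and \<delta>: "\<And>n t \<xi>. delta_division \<delta> T a b n t \<and> division_tags T n t \<xi> \<Longrightarrow>
          interval_dist (interval_delta_sum f n t \<xi>) A < \<epsilon>"
        using IR \<open>\<epsilon> > 0\<close> unfolding has_IR_delta_integral_def by meson
      then show ?thesis using dist by (intro exI[of _ \<delta>]) blast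
    qed
    show ?thesis
      unfolding has_delta_integral_def by (intro conjI allI impI; drule both; blast)
  qed
  show "has_IR_delta_integral T a b f A" if LU: "?L \<and> ?U"
    unfolding has_IR_delta_integral_def
  proof (intro allI impI)
    fix \<epsilon> :: real assume "\<epsilon> > 0"
    obtain d1 where d1: "d1 > 0" "\<And>n t \<xi>. delta_division d1 T a b n t \<and> division_tags T n t \<xi> \<Longrightarrow>
        \<bar>real_delta_sum (\<lambda>s. lower (f s)) n t \<xi> - lower A\<bar> < \<epsilon>"
      using LU \<open>\<epsilon> > 0\<close> unfolding has_delta_integral_def by meson
    obtain d2 where d2: "d2 > 0" "\<And>n t \<xi>. delta_division d2 T a b n t \<and> division_tags T n t \<xi> \<Longrightarrow>
        \<bar>real_delta_sum (\<lambda>s. upper (f s)) n t \<xi> - upper A\<bar> < \<epsilon>"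
      using LU \<open>\<epsilon> > 0\<close> unfolding has_delta_integral_def by meson
    show "\<exists>\<delta>>0. \<forall>n t \<xi>. delta_division \<delta> T a b n t \<and> division_tags T n t \<xi> \<longrightarrow>
        interval_dist (interval_delta_sum f n t \<xi>) A < \<epsilon>"
    proof (intro exI conjI allI impI)
      show "min d1 d2 > 0" using d1 d2 by simp
      fix n t \<xi> assume *: "delta_division (min d1 d2) T a b n t \<and> division_tags T n t \<xi>"
      then have "delta_division d1 T a b n t" "delta_division d2 T a b n t"
        by (auto intro: delta_division_mono)
      with * show "interval_dist (interval_delta_sum f n t \<xi>) A < \<epsilon>"
        using d1(2) d2(2) dist by blast
    qed
  qed
qed

lemma IR_delta_integral_eq:
  assumes "time_scale T" "a \<in> T" "b \<in> T" "a \<le> b" "has_IR_delta_integral T a b f A"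
  shows "IR_delta_integral T a b f = A"
  unfolding IR_delta_integral_def
proof (rule the_equality)
  fix B assume "has_IR_delta_integral T a b f B"
  with assms show "B = A"
    unfolding has_IR_delta_integral_iff interval_eq_iff
    using has_delta_integral_unique[OF assms(1-4)] by blast
qed (fact assms(5))

theorem theorem3:
  fixes T :: "real set" and a b :: real and f :: "real \<Rightarrow> real interval"
  assumes "time_scale T" and "a \<in> T" and "b \<in> T" and "a < b"
    and "interval_continuous_on (ts_Icc T a b) f"
  shows "IR_delta_integrable T a b f
    \<and> delta_integrable T a b (\<lambda>t. lower (f t))
    \<and> delta_integrable T a b (\<lambda>t. upper (f t))
    \<and> set_of (IR_delta_integral T a b f) =
        {delta_integral T a b (\<lambda>t. lower (f t)) .. delta_integral T a b (\<lambda>t. upper (f t))}"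
proof -
  have cl: "closed T" using assms(1) by (simp add: time_scale_def)
  have le: "a \<le> b" using assms(4) by simp
  note cont = interval_continuous_on_endpoints[OF assms(5)]
  let ?l = "integral {a..b} (\<lambda>x. lower (f (ts_floor T x)))"
  let ?u = "integral {a..b} (\<lambda>x. upper (f (ts_floor T x)))"
  have L: "has_delta_integral T a b (\<lambda>t. lower (f t)) ?l"
    using continuous_has_delta_integral[OF assms(1,2,4) cont(1)] .
  have U: "has_delta_integral T a b (\<lambda>t. upper (f t)) ?u"
    using continuous_has_delta_integral[OF assms(1,2,4) cont(2)] .
  have "?l \<le> ?u"
    using integrable_ts_floor_comp[OF cl assms(2) cont(1)]
      integrable_ts_floor_comp[OF cl assms(2) cont(2)]
    by (rule integral_le) simp
  then have A: "lower (Interval (?l, ?u)) = ?l" "upper (Interval (?l, ?u)) = ?u"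
    by (simp_all add: lower.rep_eq upper.rep_eq Interval_inverse)
  then have I: "has_IR_delta_integral T a b f (Interval (?l, ?u))"
    using L U by (simp add: has_IR_delta_integral_iff)
  have "set_of (IR_delta_integral T a b f) = {?l..?u}"
    unfolding IR_delta_integral_eq[OF assms(1-3) le I] set_of_eq A ..
  then show ?thesis
    unfolding delta_integral_eq[OF assms(1-3) le L] delta_integral_eq[OF assms(1-3) le U]
      IR_delta_integrable_def delta_integrable_def
    using L U I by blast
qed

end
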